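(* Let $\lambda$ be a nonzero real number and let $Y$ be the geometric random variable with parameter $0<p<1$, i.e. $P\{Y=i\}=(1-p)^{i-1}p$ for $i=1,2,\dots$. Then, for all integers $n\ge k\ge 0$, $$S_{2}^{Y}(n,k)=\frac{1}{k!}\frac{1}{(p-1)^{k}}\sum_{j=0}^{k}\binom{k}{j}(-1)^{j}H_{n}^{(j)}\Big(\frac{1}{1-p}\Big),$$ $$S_{1}^{Y}(n,k)=\sum_{j=k}^{n}\binom{n}{j}(n-1)_{n-j}p^{j}(p-1)^{n-j}S_{1}(j,k),$$ $$S_{2,\lambda}^{Y}(n,k)=\frac{1}{k!}\frac{1}{(p-1)^{k}}\sum_{j=0}^{k}\binom{k}{j}(-1)^{j}h_{n,\lambda}^{(j)}\Big(\frac{1}{1-p}\Big),$$ $$S_{1,\lambda}^{Y}(n,k)=\sum_{j=k}^{n}\binom{n}{j}(n-1)_{n-j}p^{j}(p-1)^{n-j}S_{1,\lambda}(j,k),$$ where $H_{n}^{(j)}(u)$ are the Frobenius-Euler numbers of order $j$ and $h_{n,\lambda}^{(j)}(u)$ are the degenerate Frobenius-Euler numbers of order $j$.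
   Context: Classical notions. $(x)_0=1$, $(x)_n=x(x-1)\cdots(x-n+1)$ for $n\ge1$. $S_1(n,k)$ are the (signed) Stirling numbers of the first kind: $\frac{1}{k!}(\log(1+t))^k=\sum_{n\ge k}S_1(n,k)\frac{t^n}{n!}$. For nonzero real $\lambda$: $(x)_{0,\lambda}=1$, $(x)_{n,\lambda}=x(x-\lambda)\cdots(x-(n-1)\lambda)$; $e_\lambda^x(t)=(1+\lambda t)^{x/\lambda}=\sum_{n\ge0}(x)_{n,\lambda}\frac{t^n}{n!}$, $e_\lambda(t)=e_\lambda^1(t)$; $\log_\lambda(t)=\frac1\lambda(t^\lambda-1)$. The degenerate Stirling numbers of the first kind are defined by $\frac{1}{k!}(\log_\lambda(1+t))^k=\sum_{n\ge k}S_{1,\lambda}(n,k)\frac{t^n}{n!}$. For an integer $r\ge0$ and $u\ne1$, the Frobenius-Euler numbers of order $r$ and degenerate Frobenius-Euler numbers of order $r$ are defined by $\big(\frac{1-u}{e^t-u}\big)^r=\sum_{n\ge0}H_n^{(r)}(u)\frac{t^n}{n!}$ and $\big(\frac{1-u}{e_\lambda(t)-u}\big)^r=\sum_{n\ge0}h_{n,\lambda}^{(r)}(u)\frac{t^n}{n!}$. Probabilistic versions. For a random variable $Y$ whose moment generating function exists near $0$ and with $E[Y]\ne0$, put $e_Y(t)=E[e^{Yt}]-1=\sum_{n\ge1}E[Y^n]\frac{t^n}{n!}$ and $e_{Y,\lambda}(t)=E[e_\lambda^Y(t)]-1=\sum_{n\ge1}E[(Y)_{n,\lambda}]\frac{t^n}{n!}$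 (power series in $t$), and let $\bar e_Y(t)$, $\bar e_{Y,\lambda}(t)$ be their compositional inverses. Then for $k\ge0$: $\frac{1}{k!}(e_Y(t))^k=\sum_{n\ge k}S_2^Y(n,k)\frac{t^n}{n!}$, $\frac{1}{k!}(\bar e_Y(t))^k=\sum_{n\ge k}S_1^Y(n,k)\frac{t^n}{n!}$, $\frac{1}{k!}(e_{Y,\lambda}(t))^k=\sum_{n\ge k}S_{2,\lambda}^Y(n,k)\frac{t^n}{n!}$, $\frac{1}{k!}(\bar e_{Y,\lambda}(t))^k=\sum_{n\ge k}S_{1,\lambda}^Y(n,k)\frac{t^n}{n!}$ define the probabilistic (degenerate) Stirling numbers associated with $Y$. *)

theory Defs
  imports
    "HOL-Probability.Probability"
    "HOL-Computational_Algebra.Formal_Power_Series"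
begin

text \<open>
  Generating functions are formal power series over the reals. The numbers attached to
  \<open>F(t) = (\<Sum>n. a\<^sub>n t\<^sup>n / n!)\<close> are read off as \<open>a\<^sub>n = egf_coeff F n\<close>.
\<close>

definition egf_coeff :: "real fps \<Rightarrow> nat \<Rightarrow> real" where
  "egf_coeff F n = fact n * fps_nth F n"

definition stirling_of :: "real fps \<Rightarrow> nat \<Rightarrow> nat \<Rightarrow> real" where
  "stirling_of F n k = egf_coeff (fps_const (1 / fact k) * F ^ k) n"

definition falling_fact :: "real \<Rightarrow> nat \<Rightarrow> real" where
  "falling_fact x n = (\<Prod>i<n. x - real i)"

definition deg_falling_fact :: "real \<Rightarrow> real \<Rightarrow> nat \<Rightarrow> real" where
  "deg_falling_fact l x n = (\<Prod>i<n. x - real i * l)"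

text \<open>\<open>deg_exp l x\<close> is \<open>(1 + l t) powr (x / l)\<close> and \<open>deg_log1p l\<close> is
  \<open>((1 + t) powr l - 1) / l\<close>, as series in \<open>t\<close>; both are meant for \<open>l \<noteq> 0\<close>.\<close>

definition deg_exp :: "real \<Rightarrow> real \<Rightarrow> real fps" where
  "deg_exp l x = fps_binomial (x / l) oo (fps_const l * fps_X)"

definition deg_log1p :: "real \<Rightarrow> real fps" where
  "deg_log1p l = fps_const (1 / l) * (fps_binomial l - 1)"

lemma deg_exp_nth:
  assumes "l \<noteq> 0"
  shows "fps_nth (deg_exp l x) n = deg_falling_fact l x n / fact n"
proof -
  have "fps_nth (deg_exp l x) n = l ^ n * ((x / l) gchoose n)"
    by (simp add: deg_exp_def fps_compose_linear)
  also have "\<dots> = (\<Prod>i<n. l * (x / l - real i)) / fact n"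
    by (simp add: gbinomial_prod_rev prod.distrib lessThan_atLeast0)
  also have "(\<Prod>i<n. l * (x / l - real i)) = deg_falling_fact l x n"
    using assms by (simp add: deg_falling_fact_def right_diff_distrib mult.commute)
  finally show ?thesis .
qed

text \<open>The library series \<open>fps_ln 1\<close> is \<open>log (1 + t)\<close>.\<close>

definition S1 :: "nat \<Rightarrow> nat \<Rightarrow> real" where
  "S1 = stirling_of (fps_ln 1)"

definition deg_S1 :: "real \<Rightarrow> nat \<Rightarrow> nat \<Rightarrow> real" where
  "deg_S1 l = stirling_of (deg_log1p l)"

text \<open>In the next two definitions the denominator is a unit of the ring of power series,
  as its constant coefficient is \<open>1 - u\<close>; they are meant for \<open>u \<noteq> 1\<close>.\<close>

definition frobenius_euler :: "nat \<Rightarrow> real \<Rightarrow> nat \<Rightarrow> real" where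
  "frobenius_euler r u = egf_coeff ((fps_const (1 - u) / (fps_exp 1 - fps_const u)) ^ r)"

definition deg_frobenius_euler :: "real \<Rightarrow> nat \<Rightarrow> real \<Rightarrow> nat \<Rightarrow> real" where
  "deg_frobenius_euler l r u =
     egf_coeff ((fps_const (1 - u) / (deg_exp l 1 - fps_const u)) ^ r)"

text \<open>Expectation of a random power series, taken coefficientwise.\<close>

definition fps_expectation :: "'a measure \<Rightarrow> ('a \<Rightarrow> real fps) \<Rightarrow> real fps" where
  "fps_expectation M F = Abs_fps (\<lambda>n. \<integral>\<omega>. fps_nth (F \<omega>) n \<partial>M)"

definition e_rv :: "'a measure \<Rightarrow> ('a \<Rightarrow> real) \<Rightarrow> real fps" where
  "e_rv M Y = fps_expectation M (\<lambda>\<omega>. fps_exp (Y \<omega>)) - 1"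

definition deg_e_rv :: "real \<Rightarrow> 'a measure \<Rightarrow> ('a \<Rightarrow> real) \<Rightarrow> real fps" where
  "deg_e_rv l M Y = fps_expectation M (\<lambda>\<omega>. deg_exp l (Y \<omega>)) - 1"

lemma (in prob_space) e_rv_nth:
  "fps_nth (e_rv M Y) n = (if n = 0 then 0 else expectation (\<lambda>\<omega>. Y \<omega> ^ n) / fact n)"
  by (simp add: e_rv_def fps_expectation_def prob_space)

lemma (in prob_space) deg_e_rv_nth:
  assumes "l \<noteq> 0"
  shows "fps_nth (deg_e_rv l M Y) n =
    (if n = 0 then 0 else expectation (\<lambda>\<omega>. deg_falling_fact l (Y \<omega>) n) / fact n)"
  using assms
  by (simp add: deg_e_rv_def fps_expectation_def deg_exp_nth deg_falling_fact_def prob_space)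

text \<open>\<open>fps_inv F\<close> is the compositional inverse of \<open>F\<close> when \<open>F\<close> has zero constant and
  nonzero linear coefficient; the linear coefficient of both series above is the mean of \<open>Y\<close>.\<close>

definition S2_rv :: "'a measure \<Rightarrow> ('a \<Rightarrow> real) \<Rightarrow> nat \<Rightarrow> nat \<Rightarrow> real" where
  "S2_rv M Y = stirling_of (e_rv M Y)"

definition S1_rv :: "'a measure \<Rightarrow> ('a \<Rightarrow> real) \<Rightarrow> nat \<Rightarrow> nat \<Rightarrow> real" where
  "S1_rv M Y = stirling_of (fps_inv (e_rv M Y))"

definition deg_S2_rv :: "real \<Rightarrow> 'a measure \<Rightarrow> ('a \<Rightarrow> real) \<Rightarrow> nat \<Rightarrow> nat \<Rightarrow> real" where
  "deg_S2_rv l M Y = stirling_of (deg_e_rv l M Y)"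

definition deg_S1_rv :: "real \<Rightarrow> 'a measure \<Rightarrow> ('a \<Rightarrow> real) \<Rightarrow> nat \<Rightarrow> nat \<Rightarrow> real" where
  "deg_S1_rv l M Y = stirling_of (fps_inv (deg_e_rv l M Y))"

end

theory Submission
  imports Defs
begin

text \<open>
  Write \<open>q = 1 - p\<close> and let \<open>F\<close> be the series \<open>e\<^sup>t\<close>, or its degenerate version
  \<open>(1 + l t)\<close> to the power \<open>1 / l\<close>. In both cases \<open>F\<close> has constant term \<open>1\<close> and the random
  series takes the value \<open>F\<^sup>i\<close> when \<open>Y = i\<close>, so both cases are treated together.

  Everything rests on one equation. The expectation \<open>\<Sum>i. p q\<^sup>i F\<^sup>i\<^sup>+\<^sup>1\<close> is a geometric series, so it
  equals \<open>p F / (1 - q F)\<close>, and \<open>e = E[F\<^sup>Y] - 1\<close> satisfies \<open>e (1 - q F) = F - 1\<close>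
  (\<open>geometric_expectation_power_fps\<close>). As \<open>F\<close> has constant term \<open>1\<close>, the sum does not converge
  formally; it converges coefficientwise because each coefficient of \<open>F\<^sup>i\<close> is a polynomial in \<open>i\<close>,
  which the weights \<open>q\<^sup>i\<close> dominate (\<open>summable_geometric_fps_power_nth\<close>).

  Second kind: with \<open>u = 1 / q\<close> and the Frobenius-Euler series \<open>A = (1 - u) / (F - u)\<close> the equation
  reads \<open>e = (1 - A) / (p - 1)\<close>. Expanding \<open>e\<^sup>k\<close> by the binomial theorem gives the sum over \<open>A\<^sup>j\<close>
  (\<open>stirling_of_geometric_egf\<close>).

  First kind: let \<open>L\<close> be the logarithm matching \<open>F\<close>, so that \<open>F\<close> composed with \<open>L\<close> is \<open>1 + t\<close>. The
  equation says that \<open>e\<close> composed with \<open>L\<close> is the fractional linear map \<open>t / (p - q t)\<close>, whose inverse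
  is \<open>w = p t / (1 + q t)\<close>; hence the compositional inverse of \<open>e\<close> is \<open>L\<close> composed with \<open>w\<close>
  (\<open>fps_inv_geometric_egf\<close>). The powers \<open>w\<^sup>j\<close> are negative binomial series, and their
  coefficients are the weights in front of the classical Stirling numbers
  (\<open>stirling_of_compose_mobius\<close>).
\<close>

section \<open>Expectations over a discrete distribution\<close>

text \<open>
  Since the point masses sum to \<open>1\<close>, almost surely \<open>Y\<close> takes one of the values \<open>y i\<close>. There
  \<open>f (Y \<omega>)\<close> is the sum of \<open>f (y i)\<close> times the indicator of \<open>Y = y i\<close>, and absolute convergence allows
  integrating that series term by term.
\<close>

lemma (in prob_space) expectation_discrete:
  fixes Y :: "'a \<Rightarrow> real" and y w :: "nat \<Rightarrow> real" and f :: "real \<Rightarrow> real"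
  assumes Y: "Y \<in> borel_measurable M"
    and fY: "(\<lambda>\<omega>. f (Y \<omega>)) \<in> borel_measurable M"
    and inj: "inj y"
    and w: "\<And>i. prob {\<omega> \<in> space M. Y \<omega> = y i} = w i"
    and total: "w sums 1"
    and sm: "summable (\<lambda>i. \<bar>w i * f (y i)\<bar>)"
  shows "expectation (\<lambda>\<omega>. f (Y \<omega>)) = (\<Sum>i. w i * f (y i))"
proof -
  define A where "A i = {\<omega> \<in> space M. Y \<omega> = y i}" for i
  define g where "g i \<omega> = f (y i) * indicator (A i) \<omega>" for i \<omega>
  have A: "A i \<in> sets M" for i
    unfolding A_def using Y by measurable
  have disj: "disjoint_family A"
    using inj by (auto simp: disjoint_family_on_def A_def inj_def)
  have "(\<lambda>i. prob (A i)) sums prob (\<Union>i. A i)"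
    using A disj by (intro finite_measure_UNION) auto
  with total have "prob (\<Union>i. A i) = 1"
    by (simp add: A_def w sums_iff)
  then have AE: "AE \<omega> in M. \<omega> \<in> (\<Union>i. A i)"
    using A by (subst AE_in_set_eq_1) auto
  have g_sums: "(\<lambda>i. g i \<omega>) sums f (Y \<omega>)" "summable (\<lambda>i. norm (g i \<omega>))"
    if "\<omega> \<in> (\<Union>i. A i)" for \<omega>
  proof -
    from that obtain j where j: "\<omega> \<in> A j" by auto
    then have Yj: "Y \<omega> = y j" by (simp add: A_def)
    have eq: "g i \<omega> = (if i = j then f (Y \<omega>) else 0)" for i
      using j inj by (auto simp: g_def A_def indicator_def inj_def)
    show "(\<lambda>i. g i \<omega>) sums f (Y \<omega>)"
      unfolding eq using sums_single[of j "\<lambda>_. f (Y \<omega>)"] by simp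
    have "(\<lambda>i. norm (g i \<omega>)) sums norm (f (Y \<omega>))"
      unfolding eq using sums_single[of j "\<lambda>_. norm (f (Y \<omega>))"]
      by (simp add: if_distrib cong: if_cong)
    then show "summable (\<lambda>i. norm (g i \<omega>))" by (rule sums_summable)
  qed
  have int_g: "integrable M (g i)" for i
    unfolding g_def using A by (intro integrable_mult_right integrable_real_indicator) (auto simp: less_top[symmetric])
  have Ec: "expectation (\<lambda>\<omega>. c * indicator (A i) \<omega>) = w i * c" for c i
    using A[of i] w[of i] by (simp add: A_def)
  have Eg: "expectation (g i) = w i * f (y i)" for i
    unfolding g_def by (rule Ec)
  have Eng: "expectation (\<lambda>\<omega>. norm (g i \<omega>)) = \<bar>w i * f (y i)\<bar>" for i
  proof -
    have "norm (g i \<omega>) = \<bar>f (y i)\<bar> * indicator (A i) \<omega>" for \<omega>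
      by (simp add: g_def indicator_def)
    moreover have "0 \<le> w i" by (simp flip: w)
    ultimately show ?thesis by (simp only: Ec abs_mult abs_of_nonneg)
  qed
  have "expectation (\<lambda>\<omega>. f (Y \<omega>)) = expectation (\<lambda>\<omega>. \<Sum>i. g i \<omega>)"
  proof (rule integral_cong_AE)
    show "AE \<omega> in M. f (Y \<omega>) = (\<Sum>i. g i \<omega>)"
      using AE by eventually_elim (rule sums_unique[OF g_sums(1)])
    show "(\<lambda>\<omega>. \<Sum>i. g i \<omega>) \<in> borel_measurable M"
      using int_g by (intro borel_measurable_suminf) auto
  qed (rule fY)
  also have "\<dots> = (\<Sum>i. expectation (g i))"
  proof (rule integral_suminf)
    show "AE \<omega> in M. summable (\<lambda>i. norm (g i \<omega>))"
      using AE by eventually_elim (rule g_sums(2))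
    show "summable (\<lambda>i. expectation (\<lambda>\<omega>. norm (g i \<omega>)))"
      unfolding Eng by (rule sm)
  qed (rule int_g)
  finally show ?thesis by (simp add: Eg)
qed


section \<open>Geometric series of powers of a power series\<close>

text \<open>
  Term-by-term differentiation preserves the radius of convergence, and applied to
  \<open>\<Sum>i. i\<^sup>m x\<^sup>i\<close> it raises the exponent \<open>m\<close> by one, up to an index shift.
\<close>

lemma summable_power_times_geometric:
  fixes x :: real
  assumes "\<bar>x\<bar> < 1"
  shows "summable (\<lambda>i. real i ^ m * x ^ i)"
  using assms
proof (induction m arbitrary: x)
  case 0
  then show ?case by (simp add: summable_geometric)
next
  case (Suc m)
  have "summable (\<lambda>i. diffs (\<lambda>i. real i ^ m) i * x ^ i)"
    by (rule termdiff_converges[where K = 1]) (use Suc in auto)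
  then have "summable (\<lambda>i. x * (diffs (\<lambda>i. real i ^ m) i * x ^ i))"
    by (rule summable_mult)
  also have "(\<lambda>i. x * (diffs (\<lambda>i. real i ^ m) i * x ^ i)) =
      (\<lambda>i. real (Suc i) ^ Suc m * x ^ Suc i)"
    by (simp add: diffs_def mult_ac)
  finally show ?case by (subst (asm) summable_Suc_iff)
qed

text \<open>
  For fixed \<open>n\<close> the number of terms does not depend on \<open>i\<close>, because \<open>(F - 1)\<^sup>k\<close> starts in degree \<open>k\<close>.
  So the coefficient is a polynomial in \<open>i\<close> of degree at most \<open>n\<close>, which is what makes its growth
  harmless against a geometric weight.
\<close>

lemma fps_power_nth_binomial:
  fixes F :: "real fps"
  assumes "fps_nth F 0 = 1"
  shows "fps_nth (F ^ i) n = (\<Sum>k=0..n. real (i choose k) * fps_nth ((F - 1) ^ k) n)"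
proof -
  have "F ^ i = (1 + fps_X) ^ i oo (F - 1)"
    using assms by (simp add: fps_compose_power[symmetric] fps_compose_add_distrib)
  then show ?thesis
    by (simp add: fps_binomial_of_nat[symmetric] fps_compose_nth binomial_gbinomial)
qed

lemma summable_geometric_fps_power_nth:
  fixes F :: "real fps" and x :: real
  assumes F: "fps_nth F 0 = 1" and x: "\<bar>x\<bar> < 1"
  shows "summable (\<lambda>i. \<bar>x ^ i * fps_nth (F ^ i) n\<bar>)"
proof -
  let ?h = "\<lambda>k. \<bar>fps_nth ((F - 1) ^ k) n\<bar>"
  have "summable (\<lambda>i. \<Sum>k=0..n. ?h k * (real i ^ k * \<bar>x\<bar> ^ i))"
    using x by (intro summable_sum summable_mult summable_power_times_geometric) simp
  then show ?thesis
  proof (rule summable_comparison_test'[where N = 0])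
    fix i :: nat
    have choose: "real (i choose k) \<le> real i ^ k" for k
      by (cases "k \<le> i") (simp_all add: binomial_le_pow binomial_eq_0 flip: of_nat_power)
    have "\<bar>fps_nth (F ^ i) n\<bar> \<le> (\<Sum>k=0..n. \<bar>real (i choose k) * fps_nth ((F - 1) ^ k) n\<bar>)"
      unfolding fps_power_nth_binomial[OF F] by (rule sum_abs)
    also have "\<dots> \<le> (\<Sum>k=0..n. real i ^ k * ?h k)"
      by (intro sum_mono) (auto simp: abs_mult intro!: mult_right_mono choose)
    finally have "\<bar>x\<bar> ^ i * \<bar>fps_nth (F ^ i) n\<bar> \<le> \<bar>x\<bar> ^ i * (\<Sum>k=0..n. real i ^ k * ?h k)"
      by (intro mult_left_mono) auto
    then show "norm \<bar>x ^ i * fps_nth (F ^ i) n\<bar> \<le> (\<Sum>k=0..n. ?h k * (real i ^ k * \<bar>x\<bar> ^ i))"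
      by (simp add: abs_mult power_abs sum_distrib_left mult_ac)
  qed
qed

text \<open>
  The series \<open>G = \<Sum>i. x\<^sup>i F\<^sup>i\<close>, summed coefficientwise, obeys \<open>G = 1 + x F G\<close>: splitting off \<open>i = 0\<close>
  leaves \<open>x F G\<close>, since multiplication by \<open>F\<close> combines finitely many coefficients and so commutes with
  the infinite sum. Thus \<open>G = 1 / (1 - x F)\<close>, and the series below is \<open>F G\<close>.
\<close>

lemma fps_geometric_series:
  fixes F :: "real fps" and x :: real
  assumes F: "fps_nth F 0 = 1" and x: "\<bar>x\<bar> < 1"
  shows "Abs_fps (\<lambda>n. \<Sum>i. x ^ i * fps_nth (F ^ Suc i) n) * (1 - fps_const x * F) = F"
proof -
  define G where "G = Abs_fps (\<lambda>n. \<Sum>i. x ^ i * fps_nth (F ^ i) n)"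
  have sm: "summable (\<lambda>i. x ^ i * fps_nth (F ^ i) n)" for n
    using summable_rabs_cancel[OF summable_geometric_fps_power_nth[OF F x]] .
  have GF: "Abs_fps (\<lambda>n. \<Sum>i. x ^ i * fps_nth (F ^ Suc i) n) = F * G"
  proof (rule fps_ext)
    fix n
    have "(\<Sum>i. x ^ i * fps_nth (F ^ Suc i) n) =
        (\<Sum>i. \<Sum>m=0..n. fps_nth F m * (x ^ i * fps_nth (F ^ i) (n - m)))"
      by (simp add: fps_mult_nth sum_distrib_left mult_ac)
    also have "\<dots> = (\<Sum>m=0..n. \<Sum>i. fps_nth F m * (x ^ i * fps_nth (F ^ i) (n - m)))"
      by (intro suminf_sum summable_mult sm)
    also have "\<dots> = fps_nth (F * G) n"
      by (simp add: fps_mult_nth G_def suminf_mult[OF sm])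
    finally show "fps_nth (Abs_fps (\<lambda>n. \<Sum>i. x ^ i * fps_nth (F ^ Suc i) n)) n = fps_nth (F * G) n"
      by simp
  qed
  have "G = 1 + fps_const x * (F * G)"
  proof (rule fps_ext)
    fix n
    \<comment> \<open>The index shift divides by \<open>x\<close>, hence the separate case \<open>x = 0\<close>.\<close>
    have sm': "summable (\<lambda>i. x ^ i * fps_nth (F ^ Suc i) n)"
    proof (cases "x = 0")
      case True
      then show ?thesis by (intro summable_finite[of "{0}"]) auto
    next
      case False
      have "summable (\<lambda>i. x ^ Suc i * fps_nth (F ^ Suc i) n)"
        using sm[of n] by (subst summable_Suc_iff)
      then have "summable (\<lambda>i. inverse x * (x ^ Suc i * fps_nth (F ^ Suc i) n))"
        by (rule summable_mult)
      then show ?thesis using False by (simp add: field_simps)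
    qed
    have "fps_nth G n = fps_nth (F ^ 0) n + (\<Sum>i. x ^ Suc i * fps_nth (F ^ Suc i) n)"
      using suminf_split_head[OF sm[of n]] by (simp add: G_def)
    also have "(\<Sum>i. x ^ Suc i * fps_nth (F ^ Suc i) n) = x * (\<Sum>i. x ^ i * fps_nth (F ^ Suc i) n)"
      using suminf_mult[OF sm', of x] by (simp add: mult_ac)
    finally show "fps_nth G n = fps_nth (1 + fps_const x * (F * G)) n"
      by (simp flip: GF)
  qed
  then have "G * (1 - fps_const x * F) = 1"
    by (simp add: algebra_simps)
  then show ?thesis
    unfolding GF by (simp add: mult.assoc)
qed


section \<open>The generating function of a geometric variable\<close>

text \<open>
  The equation carrying both kinds of Stirling numbers. The expectation is \<open>p F / (1 - q F)\<close> with
  \<open>q = 1 - p\<close>, and subtracting \<open>1\<close> turns the numerator into \<open>p F - 1 + q F = F - 1\<close>. The denominator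
  is kept on the left so that later steps are ring identities.
\<close>

lemma (in prob_space) geometric_expectation_power_fps:
  fixes Y :: "'a \<Rightarrow> real" and p :: real and G :: "real \<Rightarrow> real fps"
  assumes Y: "Y \<in> borel_measurable M" and p: "0 < p" "p < 1"
    and dist: "\<And>i::nat. 1 \<le> i \<Longrightarrow> prob {\<omega> \<in> space M. Y \<omega> = real i} = (1 - p) ^ (i - 1) * p"
    and G_meas: "\<And>n. (\<lambda>\<omega>. fps_nth (G (Y \<omega>)) n) \<in> borel_measurable M"
    and G_pow: "\<And>i. G (real i) = F ^ i" and F: "fps_nth F 0 = 1"
  shows "(fps_expectation M (\<lambda>\<omega>. G (Y \<omega>)) - 1) * (1 - fps_const (1 - p) * F) = F - 1"
proof -
  let ?q = "1 - p"
  have q: "\<bar>?q\<bar> < 1" using p by simp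
  have "fps_expectation M (\<lambda>\<omega>. G (Y \<omega>)) =
      fps_const p * Abs_fps (\<lambda>n. \<Sum>i. ?q ^ i * fps_nth (F ^ Suc i) n)"
  proof (rule fps_ext)
    fix n
    have "summable (\<lambda>i. \<bar>?q ^ Suc i * fps_nth (F ^ Suc i) n\<bar>)"
      using summable_geometric_fps_power_nth[OF F q] by (subst summable_Suc_iff)
    then have "summable (\<lambda>i. p / ?q * \<bar>?q ^ Suc i * fps_nth (F ^ Suc i) n\<bar>)"
      by (rule summable_mult)
    then have sm: "summable (\<lambda>i. \<bar>(?q ^ i * p) * fps_nth (G (real (Suc i))) n\<bar>)"
      unfolding G_pow using p by (simp add: abs_mult mult_ac)
    have geo: "(\<lambda>i. ?q ^ i * p) sums 1"
      using sums_mult2[OF geometric_sums[of ?q], of p] q p by simp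
    have "expectation (\<lambda>\<omega>. fps_nth (G (Y \<omega>)) n) =
        (\<Sum>i. ?q ^ i * p * fps_nth (G (real (Suc i))) n)"
      by (rule expectation_discrete[OF Y G_meas _ _ geo sm])
        (use dist[of "Suc _"] in \<open>auto simp: inj_def\<close>)
    also have "\<dots> = (\<Sum>i. p * (?q ^ i * fps_nth (F ^ Suc i) n))"
      unfolding G_pow by (simp add: mult_ac)
    also have "\<dots> = p * (\<Sum>i. ?q ^ i * fps_nth (F ^ Suc i) n)"
    proof (rule suminf_mult)
      have "summable (\<lambda>i. inverse p * (?q ^ i * p * fps_nth (G (real (Suc i))) n))"
        using summable_rabs_cancel[OF sm] by (rule summable_mult)
      then show "summable (\<lambda>i. ?q ^ i * fps_nth (F ^ Suc i) n)"
        unfolding G_pow using p by (simp add: field_simps)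
    qed
    finally show "fps_nth (fps_expectation M (\<lambda>\<omega>. G (Y \<omega>))) n =
        fps_nth (fps_const p * Abs_fps (\<lambda>n. \<Sum>i. ?q ^ i * fps_nth (F ^ Suc i) n)) n"
      by (simp add: fps_expectation_def)
  qed
  then have E: "fps_expectation M (\<lambda>\<omega>. G (Y \<omega>)) * (1 - fps_const ?q * F) = fps_const p * F"
    using fps_geometric_series[OF F q] by (simp add: mult.assoc)
  have "(fps_expectation M (\<lambda>\<omega>. G (Y \<omega>)) - 1) * (1 - fps_const ?q * F) =
      fps_const p * F - (1 - fps_const ?q * F)"
    by (simp only: left_diff_distrib E mult_1)
  also have "\<dots> = (fps_const p + fps_const ?q) * F - 1"
    by (simp only: distrib_right) simp
  finally show ?thesis by simp
qed


section \<open>Stirling numbers of the second kind\<close>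

text \<open>
  With \<open>u = 1 / (1 - p)\<close> one has \<open>1 - (1 - p) F = (p - 1) (F - u)\<close> and
  \<open>F - 1 = (F - u) - (1 - u)\<close>, so \<open>e = (1 - A) / (p - 1)\<close> for the Frobenius-Euler series \<open>A\<close>
  of order one; the claim is the binomial expansion of \<open>e\<^sup>k\<close>.
\<close>

lemma stirling_of_geometric_egf:
  fixes e F :: "real fps" and p :: real
  assumes p: "0 < p" "p < 1" and F: "fps_nth F 0 = 1"
    and e: "e * (1 - fps_const (1 - p) * F) = F - 1"
  defines "u \<equiv> 1 / (1 - p)"
  shows "stirling_of e n k = 1 / fact k * (1 / (p - 1) ^ k) *
    (\<Sum>j=0..k. real (k choose j) * (-1) ^ j *
      egf_coeff ((fps_const (1 - u) / (F - fps_const u)) ^ j) n)"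
proof -
  define A where "A = fps_const (1 - u) / (F - fps_const u)"
  have u: "(1 - p) * u = 1" "u \<noteq> 1" using p by (auto simp: u_def field_simps)
  have unit: "fps_nth (F - fps_const u) 0 \<noteq> 0" using F u by simp
  then have nz: "F - fps_const u \<noteq> 0" by auto
  have A: "A * (F - fps_const u) = fps_const (1 - u)"
    using unit by (simp add: A_def fps_divide_unit mult.assoc inverse_mult_eq_1)
  have qu: "fps_const (1 - p) * fps_const u = 1" using u by simp
  have "fps_const (1 - p) * e * (F - fps_const u) = - (e * (1 - fps_const (1 - p) * F))"
    using qu by algebra
  also have "\<dots> = fps_const (1 - u) - (F - fps_const u)"
    unfolding e by (simp flip: fps_const_sub)
  also have "\<dots> = (A - 1) * (F - fps_const u)"
    by (simp add: A left_diff_distrib)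
  finally have "fps_const (1 - p) * e = A - 1" using nz by simp
  then have eA: "e = fps_const (1 / (p - 1)) * (- A + 1)"
  proof -
    have "e = fps_const (1 / (p - 1)) * (fps_const (p - 1) * e)"
      using p by (simp flip: mult.assoc)
    also have "fps_const (p - 1) * e = - (fps_const (1 - p) * e)"
      by (simp flip: mult_minus_left)
    finally show ?thesis by (simp add: \<open>fps_const (1 - p) * e = A - 1\<close>)
  qed
  have "e ^ k = fps_const (1 / (p - 1) ^ k) * (\<Sum>j\<le>k. of_nat (k choose j) * (- A) ^ j)"
    unfolding eA power_mult_distrib binomial_ring by (simp add: fps_const_power power_one_over)
  also have "(\<Sum>j\<le>k. of_nat (k choose j) * (- A) ^ j) =
      (\<Sum>j=0..k. fps_const (real (k choose j) * (-1) ^ j) * A ^ j)"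
  proof (intro sum.cong)
    fix j
    have "(- A) ^ j = (fps_const (-1) * A) ^ j" by (simp flip: fps_const_neg)
    also have "\<dots> = fps_const ((-1) ^ j) * A ^ j"
      by (simp only: power_mult_distrib fps_const_power)
    finally show "of_nat (k choose j) * (- A) ^ j = fps_const (real (k choose j) * (-1) ^ j) * A ^ j"
      by (simp add: mult.assoc flip: fps_of_nat fps_const_mult)
  qed auto
  finally show ?thesis
    unfolding A_def[symmetric]
    by (simp add: stirling_of_def egf_coeff_def fps_sum_nth sum_distrib_left mult_ac)
qed


section \<open>Stirling numbers of the first kind\<close>

text \<open>
  Comparing linear coefficients in \<open>a oo b = fps_X\<close> shows that \<open>a\<close> has a nonzero one, so \<open>fps_inv a\<close> is a left inverse, and left
  and right inverses agree.
\<close>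

lemma fps_inv_eqI:
  fixes a b :: "real fps"
  assumes a: "fps_nth a 0 = 0" and b: "fps_nth b 0 = 0" and ab: "a oo b = fps_X"
  shows "fps_inv a = b"
proof -
  have "fps_nth (a oo b) 1 = fps_nth a 1 * fps_nth b 1"
    by (simp add: fps_compose_nth)
  with ab have a1: "fps_nth a 1 \<noteq> 0" by auto
  have "fps_inv a = fps_inv a oo (a oo b)" by (simp add: ab)
  also have "\<dots> = (fps_inv a oo a) oo b" by (rule fps_compose_assoc[OF b a])
  also have "\<dots> = b" using b by (simp add: fps_inv[OF a a1])
  finally show ?thesis .
qed

text \<open>
  The fractional linear map \<open>p t / (1 + (1 - p) t)\<close>, inverse to \<open>t / (p - (1 - p) t)\<close>.
\<close>

definition mobius_fps :: "real \<Rightarrow> real fps" where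
  "mobius_fps p = fps_const p * fps_X * inverse (1 + fps_const (1 - p) * fps_X)"

lemma mobius_fps_nth_0 [simp]: "fps_nth (mobius_fps p) 0 = 0"
  by (simp add: mobius_fps_def)

lemma mobius_fps_eq:
  "mobius_fps p * (1 + fps_const (1 - p) * fps_X) = fps_const p * fps_X"
  by (simp add: mobius_fps_def mult.assoc inverse_mult_eq_1)

text \<open>
  Substituting \<open>L\<close> for \<open>t\<close> in the equation for \<open>e\<close> replaces \<open>F\<close> by \<open>1 + t\<close> and leaves
  \<open>(e oo L) (p - (1 - p) t) = t\<close>. So \<open>e oo L\<close> is inverted by the fractional linear map above, and
  \<open>e\<close> by \<open>L\<close> composed with it.
\<close>

lemma fps_inv_geometric_egf:
  fixes e F L :: "real fps" and p :: real
  assumes p: "0 < p" and e0: "fps_nth e 0 = 0"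
    and e: "e * (1 - fps_const (1 - p) * F) = F - 1"
    and L: "fps_nth L 0 = 0" "F oo L = 1 + fps_X"
  shows "fps_inv e = L oo mobius_fps p"
proof (rule fps_inv_eqI)
  let ?w = "mobius_fps p" and ?q = "fps_const (1 - p) :: real fps"
  show "fps_nth (L oo ?w) 0 = 0" using L by simp
  have "(e * (1 - ?q * F)) oo L = (F - 1) oo L" by (simp only: e)
  then have "(e oo L) * (1 - ?q * (1 + fps_X)) = fps_X"
    using L by (simp add: fps_compose_mult_distrib fps_compose_sub_distrib)
  then have "((e oo L) * (1 - ?q * (1 + fps_X))) oo ?w = fps_X oo ?w" by simp
  then have *: "(e oo L oo ?w) * (1 - ?q * (1 + ?w)) = ?w"
    by (simp add: fps_compose_mult_distrib fps_compose_sub_distrib fps_compose_add_distrib)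
  \<comment> \<open>Multiply by the denominator \<open>1 + ?q * fps_X\<close> of \<open>?w\<close>, using
    \<open>p = p (1 + q t) - q (p t)\<close>.\<close>
  have "(e oo L oo ?w) * fps_const p =
      (e oo L oo ?w) * (fps_const p * (1 + ?q * fps_X) - ?q * (fps_const p * fps_X))"
    by (simp add: ring_distribs mult_ac)
  also have "fps_const p * (1 + ?q * fps_X) - ?q * (fps_const p * fps_X) =
      (1 - ?q) * (1 + ?q * fps_X) - ?q * (?w * (1 + ?q * fps_X))"
    by (simp only: mobius_fps_eq) simp
  also have "\<dots> = (1 - ?q * (1 + ?w)) * (1 + ?q * fps_X)"
    by (simp only: ring_distribs mult_ac mult_1 mult_1_right) simp
  also have "(e oo L oo ?w) * \<dots> = ?w * (1 + ?q * fps_X)"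
    by (simp only: * flip: mult.assoc)
  also note mobius_fps_eq
  finally have "(e oo L oo ?w) * fps_const p = fps_const p * fps_X" .
  then have "e oo L oo ?w = fps_X" using p by (simp add: mult.commute)
  then show "e oo (L oo ?w) = fps_X"
    using L by (simp add: fps_compose_assoc)
qed (rule e0)

text \<open>
  With \<open>n = j + m\<close> the falling factorial \<open>(n - 1) \<dots> j\<close> is up to sign that of \<open>- j\<close>; this brings the
  negative binomial coefficients into the shape used for Stirling numbers. Stating it with real
  subtraction covers \<open>j = m = 0\<close>.
\<close>

lemma falling_fact_eq_gbinomial:
  "falling_fact (real (j + m) - 1) m = fact m * (-1) ^ m * (- real j gchoose m)"
proof -
  have "falling_fact (real (j + m) - 1) m = fact m * ((real (j + m) - 1) gchoose m)"
    by (simp add: falling_fact_def gbinomial_prod_rev lessThan_atLeast0)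
  also have "(real (j + m) - 1) gchoose m = (-1) ^ m * (- real j gchoose m)"
    using gbinomial_negated_upper[of "- real j" m] by (simp add: algebra_simps)
  finally show ?thesis by simp
qed

lemma mobius_fps_power_nth:
  "fps_nth (mobius_fps p ^ j) n =
    (if n < j then 0 else p ^ j * (1 - p) ^ (n - j) * (- real j gchoose (n - j)))"
proof -
  let ?X = "fps_const (1 - p) * fps_X :: real fps"
  have "inverse (1 + ?X) = fps_binomial (-1) oo ?X"
    by (intro fps_inverse_unique) 
      (simp add: fps_binomial_minus_one, simp add: fps_inverse_compose fps_compose_add_distrib inverse_mult_eq_1')
  then have "inverse (1 + ?X) ^ j = fps_binomial (- real j) oo ?X"
    by (simp add: fps_compose_power fps_binomial_power)
  then have "mobius_fps p ^ j = fps_const (p ^ j) * (fps_X ^ j * (fps_binomial (- real j) oo ?X))"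
    by (simp add: mobius_fps_def power_mult_distrib fps_const_power mult.assoc)
  then show ?thesis
    by (simp add: fps_X_power_mult_nth fps_compose_linear mult.assoc)
qed

text \<open>
  Composition expands \<open>L\<^sup>k / k!\<close> in powers of the fractional linear map, so the Stirling numbers of
  \<open>L\<close> get weighted by the coefficients of those powers. Terms with \<open>j < k\<close> drop out as \<open>L\<^sup>k\<close> starts in
  degree \<open>k\<close>.
\<close>

lemma stirling_of_compose_mobius:
  assumes L: "fps_nth L 0 = 0" and "k \<le> n"
  shows "stirling_of (L oo mobius_fps p) n k =
    (\<Sum>j=k..n. real (n choose j) * falling_fact (real n - 1) (n - j) *
      p ^ j * (p - 1) ^ (n - j) * stirling_of L j k)"
proof -
  have "stirling_of (L oo mobius_fps p) n k =
      fact n * (1 / fact k * fps_nth (L ^ k oo mobius_fps p) n)"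
    by (simp add: stirling_of_def egf_coeff_def fps_compose_power)
  also have "\<dots> = (\<Sum>j=0..n. fact n / fact k * (fps_nth (L ^ k) j * fps_nth (mobius_fps p ^ j) n))"
    by (simp add: fps_compose_nth sum_distrib_left)
  also have "\<dots> = (\<Sum>j=k..n. fact n / fact k * (fps_nth (L ^ k) j * fps_nth (mobius_fps p ^ j) n))"
    using startsby_zero_power_prefix[OF L, of k] by (intro sum.mono_neutral_right) auto
  also have "\<dots> = (\<Sum>j=k..n. real (n choose j) * falling_fact (real n - 1) (n - j) *
      p ^ j * (p - 1) ^ (n - j) * stirling_of L j k)"
  proof (rule sum.cong)
    fix j assume "j \<in> {k..n}"
    then obtain m where n: "n = j + m" by (auto simp: le_iff_add)
    have "(-1) ^ m * (p - 1) ^ m = (1 - p) ^ m"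
      by (simp flip: power_mult_distrib)
    then have "falling_fact (real n - 1) m * (p - 1) ^ m =
        fact m * ((1 - p) ^ m * (- real j gchoose m))"
      unfolding n falling_fact_eq_gbinomial by (simp add: mult_ac)
    moreover have "real (n choose j) = fact n / (fact j * fact m)"
      by (simp add: n binomial_fact)
    ultimately have "real (n choose j) * fact j * (falling_fact (real n - 1) m * (p - 1) ^ m) =
        fact n * ((1 - p) ^ m * (- real j gchoose m))"
      by simp
    then show "fact n / fact k * (fps_nth (L ^ k) j * fps_nth (mobius_fps p ^ j) n) =
        real (n choose j) * falling_fact (real n - 1) (n - j) *
        p ^ j * (p - 1) ^ (n - j) * stirling_of L j k"
      by (simp add: n mobius_fps_power_nth stirling_of_def egf_coeff_def mult_ac)
  qed simp
  finally show ?thesis .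
qed


section \<open>Degenerate exponential and logarithm\<close>

lemma deg_exp_of_nat: "deg_exp l (real i) = deg_exp l 1 ^ i"
  by (simp add: deg_exp_def fps_compose_power fps_binomial_power)

lemma fps_exp_compose_ln: "fps_exp 1 oo fps_ln 1 = (1 + fps_X :: real fps)"
proof -
  have "(fps_exp 1 - 1) oo fps_ln 1 = (fps_X :: real fps)"
    using fps_inv_right[of "fps_exp 1 - 1 :: real fps"] by (simp add: fps_ln_fps_exp_inv)
  then show ?thesis by (simp add: fps_compose_sub_distrib algebra_simps)
qed

text \<open>
  The formal version of raising \<open>(1 + t)\<close> to the power \<open>d\<close> and then to the power \<open>c\<close>. By the chain
  rule the composite solves the differential equation \<open>(1 + t) B' = c d B\<close>, \<open>B(0) = 1\<close>, which
  characterises the binomial series with exponent \<open>c d\<close>.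
\<close>

lemma fps_binomial_compose_binomial:
  "fps_binomial c oo (fps_binomial d - 1) = (fps_binomial (c * d) :: real fps)"
proof -
  let ?b = "fps_binomial d :: real fps"
  let ?B = "fps_binomial c oo (?b - 1)"
  have "fps_deriv (fps_binomial c) * (1 + fps_X) = fps_const c * fps_binomial c"
    by (simp add: fps_binomial_deriv fps_divide_unit mult.assoc inverse_mult_eq_1)
  then have "(fps_deriv (fps_binomial c) * (1 + fps_X)) oo (?b - 1) =
      (fps_const c * fps_binomial c) oo (?b - 1)"
    by simp
  then have 1: "(fps_deriv (fps_binomial c) oo (?b - 1)) * ?b = fps_const c * ?B"
    by (simp add: fps_compose_mult_distrib fps_compose_add_distrib)
  have 2: "fps_deriv ?b = fps_const d * ?b * inverse (1 + fps_X)"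
    by (simp add: fps_binomial_deriv fps_divide_unit)
  have "fps_deriv ?B = (fps_deriv (fps_binomial c) oo (?b - 1)) * fps_deriv ?b"
    by (simp add: fps_compose_deriv)
  also have "\<dots> = ((fps_deriv (fps_binomial c) oo (?b - 1)) * ?b) * (fps_const d * inverse (1 + fps_X))"
    by (simp add: 2 mult_ac)
  also have "\<dots> = fps_const (c * d) * ?B / (1 + fps_X)"
    unfolding 1 by (simp add: fps_divide_unit mult_ac flip: fps_const_mult)
  finally show ?thesis
    using fps_binomial_ODE_unique'[of ?B "c * d"] by simp
qed

lemma deg_exp_compose_log:
  assumes "l \<noteq> 0"
  shows "deg_exp l 1 oo deg_log1p l = 1 + fps_X"
proof -
  have "deg_exp l 1 oo deg_log1p l =
      fps_binomial (1 / l) oo ((fps_const l * fps_X) oo deg_log1p l)"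
    unfolding deg_exp_def by (rule fps_compose_assoc[symmetric]) (simp_all add: deg_log1p_def)
  also have "(fps_const l * fps_X) oo deg_log1p l = fps_const l * deg_log1p l"
    by (simp add: fps_compose_mult_distrib deg_log1p_def)
  also have "\<dots> = fps_binomial l - 1"
    using assms by (simp add: deg_log1p_def flip: mult.assoc)
  finally show ?thesis
    using assms by (simp add: fps_binomial_compose_binomial fps_binomial_1)
qed


section \<open>Stirling numbers of a geometric variable\<close>

theorem theorem2p4:
  fixes M :: "'a measure" and Y :: "'a \<Rightarrow> real" and l p :: real and n k :: nat
  assumes "l \<noteq> 0"
    and "0 < p" and "p < 1"
    and "prob_space M"
    and "Y \<in> borel_measurable M"
    and "\<And>i::nat. 1 \<le> i \<Longrightarrow>
           measure M {\<omega> \<in> space M. Y \<omega> = real i} = (1 - p) ^ (i - 1) * p"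
    and "k \<le> n"
  shows "S2_rv M Y n k =
           1 / fact k * (1 / (p - 1) ^ k) *
           (\<Sum>j=0..k. real (k choose j) * (-1) ^ j * frobenius_euler j (1 / (1 - p)) n)
       \<and> S1_rv M Y n k =
           (\<Sum>j=k..n. real (n choose j) * falling_fact (real n - 1) (n - j) *
              p ^ j * (p - 1) ^ (n - j) * S1 j k)
       \<and> deg_S2_rv l M Y n k =
           1 / fact k * (1 / (p - 1) ^ k) *
           (\<Sum>j=0..k. real (k choose j) * (-1) ^ j * deg_frobenius_euler l j (1 / (1 - p)) n)
       \<and> deg_S1_rv l M Y n k =
           (\<Sum>j=k..n. real (n choose j) * falling_fact (real n - 1) (n - j) *
              p ^ j * (p - 1) ^ (n - j) * deg_S1 l j k)"
proof -
  interpret prob_space M by fact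
  note Y = \<open>Y \<in> borel_measurable M\<close>
  have e: "e_rv M Y * (1 - fps_const (1 - p) * fps_exp 1) = fps_exp 1 - 1"
    unfolding e_rv_def
    by (rule geometric_expectation_power_fps) (use assms in \<open>simp_all add: fps_exp_power_mult\<close>)
  have e0: "fps_nth (e_rv M Y) 0 = 0" by (simp add: e_rv_nth)
  have "(\<lambda>\<omega>. fps_nth (deg_exp l (Y \<omega>)) m) \<in> borel_measurable M" for m
    unfolding deg_exp_nth[OF \<open>l \<noteq> 0\<close>] deg_falling_fact_def using Y by measurable
  then have de: "deg_e_rv l M Y * (1 - fps_const (1 - p) * deg_exp l 1) = deg_exp l 1 - 1"
    unfolding deg_e_rv_def
    by (intro geometric_expectation_power_fps)
      (use assms in \<open>simp_all add: deg_exp_of_nat\<close>, simp add: deg_exp_def)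
  have de0: "fps_nth (deg_e_rv l M Y) 0 = 0" using assms by (simp add: deg_e_rv_nth)
  have dF0: "fps_nth (deg_exp l 1) 0 = 1" by (simp add: deg_exp_def)
  have dL0: "fps_nth (deg_log1p l) 0 = 0" by (simp add: deg_log1p_def)
  show ?thesis
  proof (intro conjI)
    show "S2_rv M Y n k = 1 / fact k * (1 / (p - 1) ^ k) *
        (\<Sum>j=0..k. real (k choose j) * (-1) ^ j * frobenius_euler j (1 / (1 - p)) n)"
      unfolding S2_rv_def frobenius_euler_def
      by (rule stirling_of_geometric_egf) (use assms e in simp_all)
    show "deg_S2_rv l M Y n k = 1 / fact k * (1 / (p - 1) ^ k) *
        (\<Sum>j=0..k. real (k choose j) * (-1) ^ j * deg_frobenius_euler l j (1 / (1 - p)) n)"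
      unfolding deg_S2_rv_def deg_frobenius_euler_def
      by (rule stirling_of_geometric_egf) (use assms de dF0 in simp_all)
    show "S1_rv M Y n k = (\<Sum>j=k..n. real (n choose j) * falling_fact (real n - 1) (n - j) *
        p ^ j * (p - 1) ^ (n - j) * S1 j k)"
      unfolding S1_rv_def S1_def
        fps_inv_geometric_egf[OF \<open>0 < p\<close> e0 e fps_ln_0 fps_exp_compose_ln]
      using \<open>k \<le> n\<close> by (intro stirling_of_compose_mobius) simp_all
    show "deg_S1_rv l M Y n k = (\<Sum>j=k..n. real (n choose j) * falling_fact (real n - 1) (n - j) *
        p ^ j * (p - 1) ^ (n - j) * deg_S1 l j k)"
      unfolding deg_S1_rv_def deg_S1_def
        fps_inv_geometric_egf[OF \<open>0 < p\<close> de0 de dL0 deg_exp_compose_log[OF \<open>l \<noteq> 0\<close>]]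
      using \<open>k \<le> n\<close> dL0 by (intro stirling_of_compose_mobius)
  qed
qed

end
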